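(* Let $\Gamma$ be a finitely generated group with infinite contortion, and let $\rho:\Gamma\to\mathrm{SL}(n,\mathbb{R})$ be a representation. Assume that $\rho(\Gamma)$ contains a non-trivial unipotent element. Then $\rho$ is not well displacing on $X_n=\mathrm{SL}(n,\mathbb{R})/\mathrm{SO}(n,\mathbb{R})$, i.e. the isometric action of $\Gamma$ on $X_n$ through $\rho$ is not well displacing.
   Context: A group $\Gamma$ has infinite contortion if for every non-torsion element $\gamma\in\Gamma$ the set of conjugacy classes of powers of $\gamma$ is infinite; that is, for every finite family $C_1,\dots,C_q$ of conjugacy classes of $\Gamma$ there exists $k>0$ with $\gamma^k\notin C_i$ for all $i$. $X_n$ carries its $\mathrm{SL}(n,\mathbb{R})$-invariant Riemannian symmetric metric. Let $\Vert\cdot\Vert$ be the word length of $\Gamma$ for a finite generating set and $\ell(\gamma)=\inf_{\eta\in\Gamma}\Vert\eta\gamma\eta^{-1}\Vert$ the translation length. The displacement of $\gamma$ acting by isometry on a metric space $X$ is $d_X(\gamma)=\inf_{x\in X}d(x,\gamma(x))$. An action of $\Gamma$ by isometries on $X$ is well displacing if there exist positive constants $A,B$ such that $d_X(\gamma)\geqslant A\,\ell(\gamma)-B$ for all $\gamma\in\Gamma$. *)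

theory Defs
  imports "HOL-Analysis.Analysis" "HOL-Algebra.Left_Coset" "HOL-Algebra.Generated_Groups"
begin

section \<open>Word length, translation length, displacement\<close>

definition word_length :: "('g, 'b) monoid_scheme \<Rightarrow> 'g set \<Rightarrow> 'g \<Rightarrow> nat" where
  "word_length G S x =
     (LEAST k. \<exists>ws. length ws = k \<and> set ws \<subseteq> S \<union> (\<lambda>s. inv\<^bsub>G\<^esub> s) ` S \<and>
                    foldr (\<lambda>a b. a \<otimes>\<^bsub>G\<^esub> b) ws \<one>\<^bsub>G\<^esub> = x)"

definition translation_length :: "('g, 'b) monoid_scheme \<Rightarrow> 'g set \<Rightarrow> 'g \<Rightarrow> nat" where
  "translation_length G S x =
     (INF h\<in>carrier G. word_length G S (h \<otimes>\<^bsub>G\<^esub> x \<otimes>\<^bsub>G\<^esub> inv\<^bsub>G\<^esub> h))"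

definition displacement :: "'x set \<Rightarrow> ('x \<Rightarrow> 'x \<Rightarrow> real) \<Rightarrow> ('x \<Rightarrow> 'x) \<Rightarrow> real" where
  "displacement X d f = (INF x\<in>X. d x (f x))"

text \<open>The constants depend on the generating set \<open>S\<close>; their existence does not. That \<open>\<phi>\<close> acts
  on \<open>X\<close> by isometries for \<open>d\<close> is deliberately not part of the definition, so that its negation
  denies the inequality.\<close>

definition well_displacing ::
  "('g, 'b) monoid_scheme \<Rightarrow> 'g set \<Rightarrow> 'x set \<Rightarrow> ('x \<Rightarrow> 'x \<Rightarrow> real) \<Rightarrow> ('g \<Rightarrow> 'x \<Rightarrow> 'x) \<Rightarrow> bool" where
  "well_displacing G S X d \<phi> \<longleftrightarrow>
     (\<exists>A B. A > 0 \<and> B > 0 \<and>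
        (\<forall>x\<in>carrier G. displacement X d (\<phi> x) \<ge> A * real (translation_length G S x) - B))"


section \<open>Infinite contortion\<close>

definition conjugacy_class :: "('g, 'b) monoid_scheme \<Rightarrow> 'g \<Rightarrow> 'g set" where
  "conjugacy_class G x = {h \<otimes>\<^bsub>G\<^esub> x \<otimes>\<^bsub>G\<^esub> inv\<^bsub>G\<^esub> h |h. h \<in> carrier G}"

definition torsion_element :: "('g, 'b) monoid_scheme \<Rightarrow> 'g \<Rightarrow> bool" where
  "torsion_element G x \<longleftrightarrow> (\<exists>k::nat. k > 0 \<and> x [^]\<^bsub>G\<^esub> k = \<one>\<^bsub>G\<^esub>)"

definition infinite_contortion :: "('g, 'b) monoid_scheme \<Rightarrow> bool" where
  "infinite_contortion G \<longleftrightarrow>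
     (\<forall>x\<in>carrier G. \<not> torsion_element G x \<longrightarrow>
        infinite {conjugacy_class G (x [^]\<^bsub>G\<^esub> k) |k::nat. k > 0})"

lemma infinite_contortion_iff_families:
  assumes "group G"
  shows "infinite_contortion G \<longleftrightarrow>
     (\<forall>x\<in>carrier G. \<not> torsion_element G x \<longrightarrow>
        (\<forall>F. finite F \<and> F \<subseteq> conjugacy_class G ` carrier G \<longrightarrow>
             (\<exists>k::nat. k > 0 \<and> (\<forall>C\<in>F. x [^]\<^bsub>G\<^esub> k \<notin> C))))"
proof -
  interpret group G by fact
  have self: "x \<in> conjugacy_class G x" if "x \<in> carrier G" for x
    unfolding conjugacy_class_def using that by (auto intro!: exI[of _ "\<one>\<^bsub>G\<^esub>"])
  have eq: "conjugacy_class G x = conjugacy_class G y"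
    if x: "x \<in> carrier G" and y: "y \<in> carrier G" and xy: "x \<in> conjugacy_class G y" for x y
  proof -
    from xy obtain h where h: "h \<in> carrier G" "x = h \<otimes>\<^bsub>G\<^esub> y \<otimes>\<^bsub>G\<^esub> inv\<^bsub>G\<^esub> h"
      unfolding conjugacy_class_def by blast
    have yx: "y = inv\<^bsub>G\<^esub> h \<otimes>\<^bsub>G\<^esub> x \<otimes>\<^bsub>G\<^esub> inv\<^bsub>G\<^esub> (inv\<^bsub>G\<^esub> h)"
      using h y by (metis inv_closed inv_inv inv_solve_left m_assoc m_closed inv_solve_right)
    have sub: "conjugacy_class G (k \<otimes>\<^bsub>G\<^esub> z \<otimes>\<^bsub>G\<^esub> inv\<^bsub>G\<^esub> k) \<subseteq> conjugacy_class G z"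
      if k: "k \<in> carrier G" and z: "z \<in> carrier G" for k z
    proof
      fix w assume "w \<in> conjugacy_class G (k \<otimes>\<^bsub>G\<^esub> z \<otimes>\<^bsub>G\<^esub> inv\<^bsub>G\<^esub> k)"
      then obtain g where g: "g \<in> carrier G"
        "w = g \<otimes>\<^bsub>G\<^esub> (k \<otimes>\<^bsub>G\<^esub> z \<otimes>\<^bsub>G\<^esub> inv\<^bsub>G\<^esub> k) \<otimes>\<^bsub>G\<^esub> inv\<^bsub>G\<^esub> g"
        unfolding conjugacy_class_def by blast
      then have "w = (g \<otimes>\<^bsub>G\<^esub> k) \<otimes>\<^bsub>G\<^esub> z \<otimes>\<^bsub>G\<^esub> inv\<^bsub>G\<^esub> (g \<otimes>\<^bsub>G\<^esub> k)"
        using k z by (simp add: m_assoc inv_mult_group)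
      moreover have "g \<otimes>\<^bsub>G\<^esub> k \<in> carrier G" using g k by simp
      ultimately show "w \<in> conjugacy_class G z" unfolding conjugacy_class_def by blast
    qed
    show ?thesis
    proof
      show "conjugacy_class G x \<subseteq> conjugacy_class G y"
        using sub[OF h(1) y] unfolding h(2) .
      show "conjugacy_class G y \<subseteq> conjugacy_class G x"
        using sub[of "inv\<^bsub>G\<^esub> h" x] h(1) x yx[symmetric] by simp
    qed
  qed
  have "infinite {conjugacy_class G (x [^]\<^bsub>G\<^esub> k) |k::nat. k > 0} \<longleftrightarrow>
        (\<forall>F. finite F \<and> F \<subseteq> conjugacy_class G ` carrier G \<longrightarrow>
             (\<exists>k::nat. k > 0 \<and> (\<forall>C\<in>F. x [^]\<^bsub>G\<^esub> k \<notin> C)))" (is "infinite ?P \<longleftrightarrow> ?R")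
    if x: "x \<in> carrier G" for x
  proof
    assume inf: "infinite ?P"
    show ?R
    proof (intro allI impI, rule ccontr)
      fix F assume F: "finite F \<and> F \<subseteq> conjugacy_class G ` carrier G"
        and "\<not> (\<exists>k::nat. k > 0 \<and> (\<forall>C\<in>F. x [^]\<^bsub>G\<^esub> k \<notin> C))"
      then have cov: "\<exists>C\<in>F. x [^]\<^bsub>G\<^esub> k \<in> C" if "k > 0" for k :: nat
        using that by (metis (no_types))
      have "?P \<subseteq> F"
      proof
        fix D assume "D \<in> ?P"
        then obtain k :: nat where k: "k > 0" "D = conjugacy_class G (x [^]\<^bsub>G\<^esub> k)" by blast
        from cov[OF k(1)] obtain C where C: "C \<in> F" "x [^]\<^bsub>G\<^esub> k \<in> C" by blast
        with F obtain y where "y \<in> carrier G" "C = conjugacy_class G y" by blast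
        with C k eq[of "x [^]\<^bsub>G\<^esub> k" y] x show "D \<in> F" by simp
      qed
      with F inf show False using finite_subset by auto
    qed
  next
    assume R: ?R
    show "infinite ?P"
    proof
      assume "finite ?P"
      moreover have "?P \<subseteq> conjugacy_class G ` carrier G" using x by auto
      ultimately obtain k :: nat where "k > 0" "\<forall>C\<in>?P. x [^]\<^bsub>G\<^esub> k \<notin> C"
        using R[rule_format, of ?P] by auto
      then show False using self[of "x [^]\<^bsub>G\<^esub> k"] x by auto
    qed
  qed
  then show ?thesis unfolding infinite_contortion_def by (intro ball_cong refl imp_cong) auto
qed


section \<open>The groups \<open>SL(n,\<real>)\<close> and \<open>SO(n,\<real>)\<close>\<close>

text \<open>Here \<open>n\<close> is \<open>CARD('n)\<close>.\<close>

definition SL_group :: "(real^'n^'n) monoid" where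
  "SL_group = \<lparr>carrier = {A. det A = 1}, mult = (**), one = mat 1\<rparr>"

definition SO_set :: "(real^'n^'n) set" where
  "SO_set = {A. orthogonal_matrix A \<and> det A = 1}"

text \<open>The multiplication of the type class on \<open>real^'n^'n\<close> is entrywise, so powers of matrices are
  written as iterates of \<open>(**)\<close>.\<close>

definition unipotent :: "real^'n^'n \<Rightarrow> bool" where
  "unipotent A \<longleftrightarrow> (\<exists>k. (((**) (A - mat 1)) ^^ k) (mat 1) = 0)"

lemma SL_simps [simp]:
  "carrier SL_group = {A. det A = 1}" "mult SL_group = (**)" "one SL_group = mat 1"
  by (simp_all add: SL_group_def)

lemma SL_inverse:
  fixes A :: "real^'n^'n"
  assumes "det A = 1"
  shows "matrix_inv A ** A = mat 1" "A ** matrix_inv A = mat 1" "det (matrix_inv A) = 1"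
proof -
  have "invertible A" using assms by (simp add: invertible_det_nz)
  then have "A ** matrix_inv A = mat 1 \<and> matrix_inv A ** A = mat 1"
    unfolding invertible_def matrix_inv_def by (rule someI_ex)
  then show "matrix_inv A ** A = mat 1" and R: "A ** matrix_inv A = mat 1" by blast+
  show "det (matrix_inv A) = 1"
    using arg_cong[OF R, of det] assms by (simp add: det_mul)
qed

lemma group_SL: "group (SL_group :: (real^'n^'n) monoid)"
proof (rule groupI)
  fix A :: "real^'n^'n" assume "A \<in> carrier SL_group"
  then show "\<exists>B\<in>carrier SL_group. B \<otimes>\<^bsub>SL_group\<^esub> A = \<one>\<^bsub>SL_group\<^esub>"
    using SL_inverse[of A] by auto
qed (auto simp: det_mul matrix_mul_assoc)

lemma SL_m_inv:
  fixes A :: "real^'n^'n"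
  assumes "det A = 1"
  shows "inv\<^bsub>SL_group\<^esub> A = matrix_inv A"
  using group.inv_equality[OF group_SL, of "matrix_inv A" A] SL_inverse[OF assms] assms by simp

lemma subgroup_SO: "subgroup (SO_set :: (real^'n^'n) set) SL_group"
proof (rule group.subgroupI[OF group_SL])
  show "(SO_set :: (real^'n^'n) set) \<noteq> {}"
    using orthogonal_matrix_id by (auto simp: SO_set_def intro!: exI[of _ "mat 1"])
next
  fix A :: "real^'n^'n" assume A: "A \<in> SO_set"
  then have "A ** transpose A = mat 1" "transpose A ** A = mat 1" "det A = 1"
    by (auto simp: SO_set_def orthogonal_matrix_def)
  then have "inv\<^bsub>SL_group\<^esub> A = transpose A"
    using group.inv_equality[OF group_SL, of "transpose A" A] by simp
  then show "inv\<^bsub>SL_group\<^esub> A \<in> SO_set" using A by (simp add: SO_set_def orthogonal_matrix_def)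
qed (auto simp: SO_set_def det_mul orthogonal_matrix_mul)


section \<open>The symmetric space \<open>SL(n,\<real>) / SO(n,\<real>)\<close>\<close>

definition symmetric_space :: "(real^'n^'n) set set" where
  "symmetric_space = lcosets\<^bsub>SL_group\<^esub> SO_set"

text \<open>
  The tangent space of \<open>SL(n,\<real>)/SO(n,\<real>)\<close> at the base point is the quotient of the traceless
  matrices by the antisymmetric ones, that is, the traceless symmetric matrices, a matrix being
  mapped to its symmetric part. The trace form \<open>tr (X ** Y)\<close> on it is invariant under conjugation
  by \<open>SO(n,\<real>)\<close>, hence extends to an \<open>SL(n,\<real>)\<close>-invariant Riemannian metric; up to a positive
  factor, which does not affect being well displacing, this is the only invariant one.
  Translating back to the base point, the projection to the quotient of a curve \<open>c\<close> in
  \<open>SL(n,\<real>)\<close> has as velocity the symmetric part of the matrix \<open>inverse (c t) ** c' t\<close>.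
  The norm of \<open>real^'n^'n\<close> is the Frobenius norm, which is the norm of the trace form on symmetric
  matrices.
\<close>

definition projected_speed :: "(real \<Rightarrow> real^'n^'n) \<Rightarrow> real \<Rightarrow> real" where
  "projected_speed c t =
     (let V = matrix_inv (c t) ** vector_derivative c (at t)
      in norm ((1/2) *\<^sub>R (V + transpose V)))"

definition projected_length :: "(real \<Rightarrow> real^'n^'n) \<Rightarrow> real" where
  "projected_length c = integral {0..1} (projected_speed c)"

text \<open>
  The Riemannian distance as the infimum of the lengths of curves. Every \<open>C\<^sup>1\<close> curve in the quotient
  lifts to a \<open>C\<^sup>1\<close> curve in \<open>SL(n,\<real>)\<close>. Piecewise \<open>C\<^sup>1\<close> curves give the same infimum, since they can be
  reparametrised so as to stop at the corners. The predicate \<open>piecewise_C1_differentiable_on\<close> would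
  be wrong here: it allows unbounded derivatives, and a curve of infinite length would have length
  0 by the convention for \<open>integral\<close>. As \<open>SL(n,\<real>)\<close> is connected, the infimum is over a nonempty set.
\<close>

definition symmetric_dist :: "(real^'n^'n) set \<Rightarrow> (real^'n^'n) set \<Rightarrow> real" where
  "symmetric_dist C D =
     Inf {projected_length c |c. c C1_differentiable_on {0..1} \<and>
            c ` {0..1} \<subseteq> carrier SL_group \<and> c 0 \<in> C \<and> c 1 \<in> D}"

definition translate :: "real^'n^'n \<Rightarrow> (real^'n^'n) set \<Rightarrow> (real^'n^'n) set" where
  "translate g C = g <#\<^bsub>SL_group\<^esub> C"

lemma translate_in_symmetric_space:
  fixes g :: "real^'n^'n"
  assumes "det g = 1" "C \<in> symmetric_space"
  shows "translate g C \<in> symmetric_space"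
proof -
  interpret group "SL_group :: (real^'n^'n) monoid" by (rule group_SL)
  interpret subgroup "SO_set :: (real^'n^'n) set" SL_group by (rule subgroup_SO)
  from assms(2) obtain a where a: "a \<in> carrier SL_group" "C = a <#\<^bsub>SL_group\<^esub> SO_set"
    by (auto simp: symmetric_space_def LCOSETS_def)
  then have "translate g C = (g ** a) <#\<^bsub>SL_group\<^esub> SO_set"
    using lcos_m_assoc[OF subset _ a(1), of g] assms(1) by (simp add: translate_def)
  moreover have "g ** a \<in> carrier SL_group" using a(1) assms(1) by (simp add: det_mul)
  ultimately show ?thesis by (auto simp: symmetric_space_def LCOSETS_def)
qed

lemma translate_mult:
  "translate g (translate h C) = translate (g ** h) C"
  by (auto simp: translate_def l_coset_def matrix_mul_assoc)

lemma translate_one: "translate (mat 1) C = C"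
  by (auto simp: translate_def l_coset_def)

lemma projected_length_translate:
  fixes c :: "real \<Rightarrow> real^'n^'n"
  assumes g: "det g = 1" and c: "c C1_differentiable_on {0..1}" and SL: "c ` {0..1} \<subseteq> carrier SL_group"
  shows "(\<lambda>t. g ** c t) C1_differentiable_on {0..1}"
    and "projected_length (\<lambda>t. g ** c t) = projected_length c"
proof -
  have bl: "bounded_linear (\<lambda>X::real^'n^'n. g ** X)"
    unfolding linear_conv_bounded_linear[symmetric]
    by (rule linearI) (simp_all add: matrix_add_ldistrib matrix_scalar_ac flip: scalar_matrix_assoc)
  from c obtain D where D: "\<And>t. t \<in> {0..1} \<Longrightarrow> (c has_vector_derivative D t) (at t)"
    and cont: "continuous_on {0..1} D"
    unfolding C1_differentiable_on_def by blast
  have gD: "((\<lambda>t. g ** c t) has_vector_derivative g ** D t) (at t)" if "t \<in> {0..1}" for t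
    using bounded_linear.has_vector_derivative[OF bl D[OF that]] .
  then show "(\<lambda>t. g ** c t) C1_differentiable_on {0..1}"
    unfolding C1_differentiable_on_def
    by (intro exI[of _ "\<lambda>t. g ** D t"] conjI ballI bounded_linear.continuous_on[OF bl cont]) auto
  have "projected_speed (\<lambda>t. g ** c t) t = projected_speed c t" if t: "t \<in> {0..1}" for t
  proof -
    have ct: "det (c t) = 1" using subsetD[OF SL imageI[OF t]] by simp
    have "inv\<^bsub>SL_group\<^esub> (g ** c t) = inv\<^bsub>SL_group\<^esub> c t ** inv\<^bsub>SL_group\<^esub> g"
      using group.inv_mult_group[OF group_SL, of g "c t"] g ct by simp
    then have inv: "matrix_inv (g ** c t) = matrix_inv (c t) ** matrix_inv g"
      using g ct by (simp only: SL_m_inv det_mul mult_1)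
    have "matrix_inv (g ** c t) ** (g ** D t) = matrix_inv (c t) ** ((matrix_inv g ** g) ** D t)"
      unfolding inv by (simp only: matrix_mul_assoc)
    then have V: "matrix_inv (g ** c t) ** (g ** D t) = matrix_inv (c t) ** D t"
      by (simp only: SL_inverse(1)[OF g] matrix_mul_lid)
    show ?thesis
      unfolding projected_speed_def
        vector_derivative_at[OF gD[OF t]] vector_derivative_at[OF D[OF t]] V ..
  qed
  then show "projected_length (\<lambda>t. g ** c t) = projected_length c"
    unfolding projected_length_def by (intro integral_cong)
qed

lemma symmetric_dist_translate:
  fixes g :: "real^'n^'n"
  assumes g: "det g = 1"
  shows "symmetric_dist (translate g C) (translate g D) = symmetric_dist C D"
proof -
  define L where "L C D = {projected_length c |c. c C1_differentiable_on {0..1} \<and>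
      c ` {0..1} \<subseteq> carrier SL_group \<and> c 0 \<in> C \<and> c 1 \<in> D}" for C D :: "(real^'n^'n) set"
  have sub: "L C D \<subseteq> L (translate h C) (translate h D)" if h: "det h = 1" for h C D
  proof
    fix x assume "x \<in> L C D"
    then obtain c where c: "x = projected_length c" "c C1_differentiable_on {0..1}"
      "c ` {0..1} \<subseteq> carrier SL_group" "c 0 \<in> C" "c 1 \<in> D" unfolding L_def by blast
    then have "(\<lambda>t. h ** c t) C1_differentiable_on {0..1}"
      "x = projected_length (\<lambda>t. h ** c t)"
      using projected_length_translate[OF h] by auto
    moreover have "(\<lambda>t. h ** c t) ` {0..1} \<subseteq> carrier SL_group"
      using c(3) h by (auto simp: det_mul)
    moreover have "h ** c 0 \<in> translate h C" "h ** c 1 \<in> translate h D"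
      using c by (auto simp: translate_def l_coset_def)
    ultimately show "x \<in> L (translate h C) (translate h D)" unfolding L_def by blast
  qed
  have "L (translate g C) (translate g D) \<subseteq> L C D"
    using sub[of "matrix_inv g" "translate g C" "translate g D"] SL_inverse[OF g]
    by (simp add: translate_mult translate_one)
  with sub[OF g] have "L (translate g C) (translate g D) = L C D" by blast
  then show ?thesis by (simp add: symmetric_dist_def L_def)
qed

end

theory Submission
  imports Defs
begin

text \<open>
  Let \<open>\<rho> \<gamma> = u\<close> be unipotent and non-trivial. In a basis adapted to the flag of the kernels of the powers
  of \<open>u - 1\<close>, all powers of \<open>u\<close> become unitriangular, and conjugating by diagonal matrices brings each
  of them arbitrarily close to 1. So all \<open>\<gamma>\<^sup>k\<close> have displacement at most 1, and if the action were well
  displacing, their translation lengths would be bounded. As there are only finitely many words of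
  bounded length, the powers of \<open>\<gamma>\<close> would lie in finitely many conjugacy classes, although \<open>\<gamma>\<close> is not
  a torsion element because \<open>u\<close> is not.
\<close>

section \<open>Words of bounded length\<close>

text \<open>Ensures that the \<open>LEAST\<close> in \<open>word_length\<close> ranges over a
  non-empty set and is therefore attained. Products correspond to concatenated words.\<close>

lemma (in group) generate_words:
  assumes "S \<subseteq> carrier G" "x \<in> generate G S"
  shows "\<exists>ws. set ws \<subseteq> S \<union> (\<lambda>s. inv s) ` S \<and> foldr (\<otimes>) ws \<one> = x"
  using assms(2)
proof induction
  case one
  show ?case by (intro exI[of _ "[]"]) simp
next
  case (incl h)
  with assms(1) show ?case by (intro exI[of _ "[h]"]) auto
next
  case (inv h)
  with assms(1) show ?case by (intro exI[of _ "[inv h]"]) auto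
next
  case (eng x y)
  then obtain vs ws where vs: "set vs \<subseteq> S \<union> (\<lambda>s. inv s) ` S" "foldr (\<otimes>) vs \<one> = x"
    and ws: "set ws \<subseteq> S \<union> (\<lambda>s. inv s) ` S" "foldr (\<otimes>) ws \<one> = y" by blast
  have gens: "S \<union> (\<lambda>s. inv s) ` S \<subseteq> carrier G" using assms(1) by auto
  have y: "y \<in> carrier G" using generate_in_carrier[OF assms(1) eng(2)] .
  have append: "foldr (\<otimes>) (us @ ws) \<one> = foldr (\<otimes>) us \<one> \<otimes> y \<and> foldr (\<otimes>) us \<one> \<in> carrier G"
    if "set us \<subseteq> carrier G" for us
    using that by (induction us) (auto simp: ws(2) y m_assoc)
  show ?case
    using append[of vs] vs ws(1) gens by (intro exI[of _ "vs @ ws"]) auto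
qed

text \<open>Such an element is the value of a word with at most \<open>m\<close> letters in a finite
  alphabet.\<close>

lemma (in group) finite_word_length_le:
  assumes "finite S" "S \<subseteq> carrier G" "generate G S = carrier G"
  shows "finite {x \<in> carrier G. word_length G S x \<le> m}"
proof -
  let ?T = "S \<union> (\<lambda>s. inv s) ` S"
  let ?W = "{ws. set ws \<subseteq> ?T \<and> length ws \<le> m}"
  have "{x \<in> carrier G. word_length G S x \<le> m} \<subseteq> (\<lambda>ws. foldr (\<otimes>) ws \<one>) ` ?W"
  proof clarify
    fix x assume x: "x \<in> carrier G" and le: "word_length G S x \<le> m"
    have "\<exists>k ws. length ws = k \<and> set ws \<subseteq> ?T \<and> foldr (\<otimes>) ws \<one> = x"
      using generate_words[OF assms(2), of x] assms(3) x by auto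
    from LeastI_ex[OF this] obtain ws where
      "length ws = word_length G S x" "set ws \<subseteq> ?T" "foldr (\<otimes>) ws \<one> = x"
      unfolding word_length_def by auto
    with le show "x \<in> (\<lambda>ws. foldr (\<otimes>) ws \<one>) ` ?W"
      by (intro image_eqI[of _ _ ws]) auto
  qed
  moreover have "finite ?W" using finite_lists_length_le[of ?T m] assms(1) by simp
  ultimately show ?thesis using finite_subset by blast
qed

section \<open>Conjugacy classes of bounded translation length\<close>

lemma (in group) conjugacy_class_conj_subset:
  assumes "h \<in> carrier G" "x \<in> carrier G"
  shows "conjugacy_class G (h \<otimes> x \<otimes> inv h) \<subseteq> conjugacy_class G x"
proof
  fix w assume "w \<in> conjugacy_class G (h \<otimes> x \<otimes> inv h)"
  then obtain g where g: "g \<in> carrier G" "w = g \<otimes> (h \<otimes> x \<otimes> inv h) \<otimes> inv g"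
    unfolding conjugacy_class_def by blast
  with assms have "w = (g \<otimes> h) \<otimes> x \<otimes> inv (g \<otimes> h)" by (simp add: m_assoc inv_mult_group)
  with g(1) assms(1) show "w \<in> conjugacy_class G x" unfolding conjugacy_class_def by blast
qed

lemma (in group) conjugacy_class_conj:
  assumes "h \<in> carrier G" "x \<in> carrier G"
  shows "conjugacy_class G (h \<otimes> x \<otimes> inv h) = conjugacy_class G x"
proof
  have "inv h \<otimes> (h \<otimes> x \<otimes> inv h) \<otimes> inv (inv h) = x"
    using assms by (metis inv_closed inv_inv inv_solve_left m_assoc m_closed inv_solve_right)
  then show "conjugacy_class G x \<subseteq> conjugacy_class G (h \<otimes> x \<otimes> inv h)"
    using conjugacy_class_conj_subset[of "inv h" "h \<otimes> x \<otimes> inv h"] assms by simp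
qed (rule conjugacy_class_conj_subset[OF assms])

lemma (in group) finite_classes_translation_length_le:
  assumes "finite S" "S \<subseteq> carrier G" "generate G S = carrier G"
  shows "finite {conjugacy_class G x |x. x \<in> carrier G \<and> translation_length G S x \<le> m}"
proof (rule finite_subset)
  show "finite (conjugacy_class G ` {x \<in> carrier G. word_length G S x \<le> m})"
    using finite_word_length_le[OF assms] by simp
  show "{conjugacy_class G x |x. x \<in> carrier G \<and> translation_length G S x \<le> m}
    \<subseteq> conjugacy_class G ` {x \<in> carrier G. word_length G S x \<le> m}"
  proof clarify
    fix x assume x: "x \<in> carrier G" and le: "translation_length G S x \<le> m"
    \<comment> \<open>An infimum of natural numbers is attained, so some conjugate of
      \<open>x\<close> has word length equal to the translation length and represents the
      class.\<close>
    have "translation_length G S x \<in> (\<lambda>h. word_length G S (h \<otimes> x \<otimes> inv h)) ` carrier G"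
      unfolding translation_length_def by (rule Inf_nat_def1) auto
    then obtain h where h: "h \<in> carrier G"
      "translation_length G S x = word_length G S (h \<otimes> x \<otimes> inv h)" by blast
    show "conjugacy_class G x \<in> conjugacy_class G ` {x \<in> carrier G. word_length G S x \<le> m}"
      using h x le conjugacy_class_conj[OF h(1) x]
      by (intro image_eqI[of _ _ "h \<otimes> x \<otimes> inv h"]) auto
  qed
qed

text \<open>Separates the group theory from the geometry, which enters only through
  \<open>bound\<close>; what matters is that \<open>C\<close> does not depend on
  \<open>k\<close>.\<close>

lemma (in group) not_well_displacing_if_bounded_on_powers:
  assumes S: "finite S" "S \<subseteq> carrier G" "generate G S = carrier G"
    and G: "infinite_contortion G"
    and x: "x \<in> carrier G" "\<not> torsion_element G x"
    and bound: "\<And>k::nat. displacement X d (\<phi> (x [^] k)) \<le> C"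
  shows "\<not> well_displacing G S X d \<phi>"
proof
  assume "well_displacing G S X d \<phi>"
  then obtain A B where A: "A > 0"
    and wd: "\<And>y. y \<in> carrier G \<Longrightarrow>
      A * real (translation_length G S y) - B \<le> displacement X d (\<phi> y)"
    unfolding well_displacing_def by blast
  \<comment> \<open>The inequality of \<open>wd\<close> is solved for the translation length and
    rounded up to a natural number.\<close>
  have "translation_length G S (x [^] k) \<le> nat \<lceil>(B + C) / A\<rceil>" for k :: nat
  proof -
    have "A * real (translation_length G S (x [^] k)) \<le> B + C"
      using wd[of "x [^] k"] bound[of k] x by simp
    then have "real (translation_length G S (x [^] k)) \<le> (B + C) / A"
      using A by (simp add: field_simps)
    then show ?thesis by linarith
  qed
  then have "{conjugacy_class G (x [^] k) |k::nat. k > 0} \<subseteq>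
    {conjugacy_class G y |y. y \<in> carrier G \<and> translation_length G S y \<le> nat \<lceil>(B + C) / A\<rceil>}"
    using x by blast
  with finite_classes_translation_length_le[OF S] have
    "finite {conjugacy_class G (x [^] k) |k::nat. k > 0}" using finite_subset by blast
  with G x show False unfolding infinite_contortion_def by blast
qed


section \<open>Nilpotent matrices\<close>

lemma bounded_bilinear_matrix_mult:
  "bounded_bilinear ((**) :: real^'n^'n \<Rightarrow> real^'n^'n \<Rightarrow> real^'n^'n)"
  unfolding bilinear_conv_bounded_bilinear[symmetric] bilinear_def
  by (auto intro!: linearI simp: matrix_matrix_mult_def vec_eq_iff sum.distrib sum_distrib_left
      algebra_simps)

interpretation matrix: bounded_bilinear "(**) :: real^'n^'n \<Rightarrow> real^'n^'n \<Rightarrow> real^'n^'n"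
  by (rule bounded_bilinear_matrix_mult)

text \<open>Induction on \<open>k\<close>: a basis of the kernel of \<open>f ^^ k\<close> is
  extended to one of the kernel of \<open>f ^^ Suc k\<close>, and \<open>h b\<close> records the
  stage at which \<open>b\<close> enters. As \<open>f\<close> maps each kernel into the previous
  one, it lowers \<open>h\<close>.\<close>

lemma nilpotent_adapted_basis:
  fixes f :: "'a::real_vector \<Rightarrow> 'a"
  assumes "linear f"
  shows "\<exists>B (h::'a \<Rightarrow> nat). independent B \<and> span B = {x. (f ^^ k) x = 0} \<and>
    (\<forall>b\<in>B. h b < k \<and> f b \<in> span {b'\<in>B. h b' < h b})"
proof (induction k)
  case 0
  show ?case by (intro exI[of _ "{}"]) (auto simp: independent_empty)
next
  case (Suc k)
  then obtain B h where B: "independent B" "span B = {x. (f ^^ k) x = 0}"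
    and h: "\<And>b. b \<in> B \<Longrightarrow> h b < k \<and> f b \<in> span {b'\<in>B. h b' < h b}" by blast
  interpret f: linear f by fact
  have lin: "linear (f ^^ k)" for k
  proof (induction k)
    case 0
    show ?case using linear_id by (simp add: id_def)
  next
    case (Suc k)
    then show ?case using linear_compose[OF Suc assms] by (simp add: o_def)
  qed
  have "(f ^^ Suc k) x = 0" if "x \<in> B" for x
  proof -
    have "(f ^^ k) x = 0" using that B(2) span_base by blast
    then show ?thesis using f.zero by simp
  qed
  then obtain B' where B': "B \<subseteq> B'" "B' \<subseteq> {x. (f ^^ Suc k) x = 0}" "independent B'"
    "{x. (f ^^ Suc k) x = 0} \<subseteq> span B'"
    using maximal_independent_subset_extend[of B "{x. (f ^^ Suc k) x = 0}"] B(1) by blast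
  have span: "span B' = {x. (f ^^ Suc k) x = 0}"
    using B'(2,4) span_minimal[OF B'(2)] linear_subspace_kernel[OF lin[of "Suc k"]] by blast
  \<comment> \<open>New vectors get height \<open>k\<close>, strictly above all old ones, so
    anything in the span of \<open>B\<close> is lower than they are.\<close>
  define h' where "h' b = (if b \<in> B then h b else k)" for b
  have "f b \<in> span {b'\<in>B'. h' b' < h' b}" if b: "b \<in> B'" for b
  proof (cases "b \<in> B")
    case True
    then have "{b'\<in>B. h b' < h b} \<subseteq> {b'\<in>B'. h' b' < h' b}" using B'(1) by (auto simp: h'_def)
    with h[OF True] show ?thesis using span_mono by blast
  next
    case False
    have "(f ^^ k) (f b) = 0" using B'(2) b by (auto simp: funpow_swap1)
    then have "f b \<in> span B" using B(2) by blast
    moreover have "B \<subseteq> {b'\<in>B'. h' b' < h' b}" using B'(1) h False by (auto simp: h'_def)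
    ultimately show ?thesis using span_mono by blast
  qed
  moreover have "h' b < Suc k" if "b \<in> B'" for b
    using h[of b] by (auto simp: h'_def)
  ultimately show ?case using B'(3) span by blast
qed

section \<open>Matrices triangular with respect to a height of the indices\<close>

text \<open>The heights replace an order on \<open>'n\<close>: once the indices are sorted by
  \<open>h\<close>, the matrix is strictly upper triangular in the usual sense, with zero blocks on
  the diagonal.\<close>

definition strictly_triangular :: "('n \<Rightarrow> nat) \<Rightarrow> real^'n^'n \<Rightarrow> bool" where
  "strictly_triangular h M \<longleftrightarrow> (\<forall>i j. M $ i $ j \<noteq> 0 \<longrightarrow> h i < h j)"

lemma strictly_triangular_zero: "strictly_triangular h 0"
  by (simp add: strictly_triangular_def)

lemma strictly_triangular_add:
  "strictly_triangular h M \<Longrightarrow> strictly_triangular h N \<Longrightarrow> strictly_triangular h (M + N)"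
  unfolding strictly_triangular_def by (metis add.right_neutral vector_add_component)

lemma strictly_triangular_scaleR:
  "strictly_triangular h M \<Longrightarrow> strictly_triangular h (t *\<^sub>R M)"
  unfolding strictly_triangular_def by simp

lemma strictly_triangular_mult:
  assumes "strictly_triangular h M" "strictly_triangular h N"
  shows "strictly_triangular h (M ** N)"
  unfolding strictly_triangular_def
proof (intro allI impI)
  fix i j assume "(M ** N) $ i $ j \<noteq> 0"
  then have "(\<Sum>k\<in>UNIV. M $ i $ k * N $ k $ j) \<noteq> 0" by (simp add: matrix_matrix_mult_def)
  then obtain k where "M $ i $ k * N $ k $ j \<noteq> 0" by (meson sum.not_neutral_contains_not_neutral)
  then show "h i < h j"
    using assms unfolding strictly_triangular_def
    by (metis mult_eq_0_iff order.strict_trans)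
qed

lemma matrix_funpow_vector:
  fixes N :: "real^'n^'n"
  shows "(((*v) N) ^^ k) x = (((**) N) ^^ k) (mat 1) *v x"
  by (induction k) (simp_all add: matrix_vector_mul_assoc)

text \<open>The columns of \<open>a\<close> are the adapted basis. Column \<open>j\<close> of
  \<open>a' ** N ** a\<close> then holds the coordinates of the image of the \<open>j\<close>-th
  basis vector, which involves lower heights only.\<close>

lemma nilpotent_similar_strictly_triangular:
  fixes N :: "real^'n^'n"
  assumes "(((**) N) ^^ k) (mat 1) = 0"
  shows "\<exists>(a::real^'n^'n) (a'::real^'n^'n) h. a' ** a = mat 1 \<and> strictly_triangular h (a' ** N ** a)"
proof -
  have lin: "linear ((*v) N)" by simp
  obtain B and h :: "real^'n \<Rightarrow> nat" where B: "independent B"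
    "span B = {x. (((*v) N) ^^ k) x = 0}"
    and h: "\<And>b. b \<in> B \<Longrightarrow> N *v b \<in> span {b'\<in>B. h b' < h b}"
    using nilpotent_adapted_basis[OF lin, of k] by blast
  \<comment> \<open>The kernel of the \<open>k\<close>-th power is the whole space.\<close>
  have span: "span B = UNIV" using B(2) assms by (simp add: matrix_funpow_vector)
  have fin: "finite B" using independent_imp_finite[OF B(1)] .
  have "card B = DIM(real^'n)"
    using basis_card_eq_dim[of B UNIV] B(1) span by (simp add: dim_UNIV)
  then have "card B = card (UNIV :: 'n set)" by simp
  then obtain \<beta> :: "'n \<Rightarrow> real^'n" where \<beta>: "bij_betw \<beta> UNIV B"
    using finite_same_card_bij[of "UNIV :: 'n set" B] fin by auto
  define a :: "real^'n^'n" where "a = (\<chi> i j. \<beta> j $ i)"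
  have col: "column j a = \<beta> j" for j by (simp add: a_def column_def vec_eq_iff)
  have "columns a = B" using \<beta> by (auto simp: columns_def col bij_betw_def)
  then have "vec.span (columns a) = UNIV" using span by (simp add: span_vec_eq)
  then obtain a' where "a ** a' = mat 1" using matrix_right_invertible_span_columns[of a] by blast
  then have a': "a' ** a = mat 1" using matrix_left_right_inverse by blast
  have mult_\<beta>: "(P ** a) $ i $ j = (P *v \<beta> j) $ i" for P :: "real^'n^'n" and i j
    by (simp add: a_def matrix_matrix_mult_def matrix_vector_mult_def)
  have "strictly_triangular (h \<circ> \<beta>) (a' ** N ** a)"
    unfolding strictly_triangular_def
  proof (intro allI impI, rule ccontr)
    fix i j assume ne: "(a' ** N ** a) $ i $ j \<noteq> 0" and le: "\<not> (h \<circ> \<beta>) i < (h \<circ> \<beta>) j"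
    \<comment> \<open>Row \<open>i\<close> of \<open>a'\<close> reads off the coordinate along
      \<open>\<beta> i\<close>, which is at least as high as \<open>\<beta> j\<close> and hence not
      among these vectors.\<close>
    have "{b'\<in>B. h b' < h (\<beta> j)} \<subseteq> {x. (a' *v x) $ i = 0}"
    proof clarify
      fix b assume b: "b \<in> B" "h b < h (\<beta> j)"
      then obtain l where l: "b = \<beta> l" using \<beta> by (auto simp: bij_betw_def)
      with le b have "l \<noteq> i" by auto
      then show "(a' *v b) $ i = 0" using mult_\<beta>[of a' i l] by (simp add: a' l mat_def)
    qed
    moreover have "subspace {x. (a' *v x) $ i = 0}"
      by (auto simp: subspace_def matrix_vector_right_distrib matrix_vector_mult_scaleR)
    ultimately have "span {b'\<in>B. h b' < h (\<beta> j)} \<subseteq> {x. (a' *v x) $ i = 0}"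
      by (rule span_minimal)
    moreover have "\<beta> j \<in> B" using \<beta> by (auto simp: bij_betw_def)
    ultimately have "(a' *v (N *v \<beta> j)) $ i = 0" using h by blast
    with ne show False by (simp add: mult_\<beta> matrix_vector_mul_assoc)
  qed
  with a' show ?thesis by blast
qed

section \<open>Conjugation by diagonal matrices\<close>

lemma diagonal_matrix_conj:
  fixes M :: "real^'n^'n" and p q :: "'n \<Rightarrow> real"
  shows "((\<chi> i j. if i = j then p i else 0) ** M ** (\<chi> i j. if i = j then q i else 0)) $ i $ j
    = p i * M $ i $ j * q j"
  by (simp add: matrix_matrix_mult_def if_distrib[of "\<lambda>x. x * _"] if_distrib[of "\<lambda>x. _ * x"]
      cong: if_cong)

lemma diagonal_matrix_mult:
  fixes p q :: "'n::finite \<Rightarrow> real"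
  shows "(\<chi> i j. if i = j then p i else 0) ** (\<chi> i j. if i = j then q i else 0)
    = ((\<chi> i j. if i = j then p i * q i else 0) :: real^'n^'n)"
  using diagonal_matrix_conj[of p "mat 1" q] unfolding matrix_mul_rid
  by (auto simp: vec_eq_iff mat_def)

lemma strictly_triangular_diagonal_conj:
  fixes M :: "real^'n^'n"
  assumes "strictly_triangular h M"
  shows "strictly_triangular h
    ((\<chi> i j. if i = j then p i else 0) ** M ** (\<chi> i j. if i = j then q i else 0))"
  using assms unfolding strictly_triangular_def diagonal_matrix_conj by simp

text \<open>The entry \<open>(i, j)\<close> is multiplied by \<open>s\<close> to the power \<open>h j - h i\<close>. Shifting the exponents of the
  diagonal matrix by the mean of \<open>h\<close> makes its determinant 1.\<close>

lemma strictly_triangular_shrink: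
  fixes M :: "real^'n^'n"
  assumes M: "strictly_triangular h M" and "\<delta> > 0"
  shows "\<exists>(d::real^'n^'n) (d'::real^'n^'n). det d = 1 \<and> d' ** d = mat 1 \<and> strictly_triangular h (d' ** M ** d)
    \<and> norm (d' ** M ** d) \<le> \<delta>"
proof -
  \<comment> \<open>The bound 1 lets higher powers of \<open>s\<close> be estimated by
    \<open>s\<close>; the other one gives \<open>s * norm M \<le> \<delta>\<close>, and the summand
    1 keeps its denominator positive.\<close>
  define s where "s = min 1 (\<delta> / (norm M + 1))"
  have s: "0 < s" "s \<le> 1" using assms(2) by (auto simp: s_def add_nonneg_pos)
  have "s * norm M \<le> \<delta> / (norm M + 1) * (norm M + 1)"
    using assms(2) by (intro mult_mono) (auto simp: s_def)
  also have "\<dots> = \<delta>"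
    by (metis add_nonneg_pos nonzero_eq_divide_eq norm_ge_zero order_less_irrefl zero_less_one)
  finally have sM: "s * norm M \<le> \<delta>" .
  define m where "m = (\<Sum>i\<in>UNIV. real (h i)) / real CARD('n)"
  define p where "p i = s powr (m - real (h i))" for i
  define q where "q i = s powr (real (h i) - m)" for i
  define d :: "real^'n^'n" where "d = (\<chi> i j. if i = j then q i else 0)"
  define d' :: "real^'n^'n" where "d' = (\<chi> i j. if i = j then p i else 0)"
  have "det d = (\<Prod>i\<in>UNIV. q i)"
    unfolding d_def by (subst det_diagonal) auto
  also have "\<dots> = s powr (\<Sum>i\<in>UNIV. real (h i) - m)"
    unfolding q_def using s by (subst powr_sum) auto
  also have "(\<Sum>i\<in>UNIV. real (h i) - m) = 0"
    by (simp add: sum_subtractf m_def)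
  finally have det: "det d = 1" using s by simp
  have "p i * q i = 1" for i
    using s by (simp add: p_def q_def flip: powr_add)
  then have inv: "d' ** d = mat 1"
    unfolding d_def d'_def diagonal_matrix_mult by (simp add: mat_def cong: if_cong)
  have entry: "norm ((d' ** M ** d) $ i $ j) \<le> norm ((s *\<^sub>R M) $ i $ j)" for i j
  proof (cases "M $ i $ j = 0")
    case True
    then show ?thesis by (simp add: d_def d'_def diagonal_matrix_conj)
  next
    case False
    then have "h i < h j" using M by (simp add: strictly_triangular_def)
    \<comment> \<open>The heights are natural numbers, so the exponent is at least 1.\<close>
    then have "s powr (real (h j) - real (h i)) \<le> s powr 1"
      using s by (intro powr_mono') auto
    moreover have "p i * q j = s powr (real (h j) - real (h i))"
      by (simp add: p_def q_def flip: powr_add)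
    ultimately have "p i * q j \<le> s" "0 \<le> p i * q j" using s by auto
    then have "(p i * q j) * \<bar>M $ i $ j\<bar> \<le> s * \<bar>M $ i $ j\<bar>" by (intro mult_right_mono) auto
    moreover have "\<bar>p i * M $ i $ j * q j\<bar> = \<bar>p i * q j\<bar> * \<bar>M $ i $ j\<bar>"
      by (simp add: abs_mult)
    ultimately have "\<bar>p i * M $ i $ j * q j\<bar> \<le> s * \<bar>M $ i $ j\<bar>"
      using \<open>0 \<le> p i * q j\<close> by simp
    moreover have "norm ((s *\<^sub>R M) $ i $ j) = s * \<bar>M $ i $ j\<bar>"
      using s by (simp add: abs_mult)
    ultimately show ?thesis
      unfolding d_def d'_def diagonal_matrix_conj real_norm_def by simp
  qed
  have "norm (d' ** M ** d) \<le> norm (s *\<^sub>R M)"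
    by (intro norm_le_componentwise_cart entry)
  with sM s have "norm (d' ** M ** d) \<le> \<delta>" by simp
  with det inv strictly_triangular_diagonal_conj[OF M] show ?thesis
    unfolding d_def d'_def by blast
qed

lemma continuous_det: "continuous_on UNIV (det :: real^'n^'n \<Rightarrow> real)"
  unfolding det_def by (intro continuous_intros)

text \<open>The determinant is constant on a conjugacy class, and this one accumulates at \<open>mat 1\<close>.\<close>

lemma det_unitriangular:
  fixes M :: "real^'n^'n"
  assumes "strictly_triangular h M"
  shows "det (mat 1 + M) = 1"
proof (rule ccontr)
  assume ne: "det (mat 1 + M) \<noteq> 1"
  have "isCont (det :: real^'n^'n \<Rightarrow> real) (mat 1)"
    using continuous_on_interior[OF continuous_det] by simp
  \<comment> \<open>The tolerance is the supposed distance of the determinant from 1, which a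
    conjugate near \<open>mat 1\<close> cannot undercut.\<close>
  then obtain \<delta> where \<delta>: "\<delta> > 0"
    "\<And>X::real^'n^'n. dist X (mat 1) < \<delta> \<Longrightarrow> dist (det X) 1 < \<bar>det (mat 1 + M) - 1\<bar>"
    using ne unfolding continuous_at_eps_delta det_I
    by (metis right_minus_eq zero_less_abs_iff)
  obtain d d' where d: "det d = 1" "d' ** d = mat 1" "norm (d' ** M ** d) \<le> \<delta> / 2"
    using strictly_triangular_shrink[OF assms, of "\<delta> / 2"] \<delta>(1) by auto
  have "det d' = 1" using arg_cong[OF d(2), of det] d(1) by (simp add: det_mul)
  then have "det (d' ** (mat 1 + M) ** d) = det (mat 1 + M)" using d(1) by (simp add: det_mul)
  moreover have "d' ** (mat 1 + M) ** d = mat 1 + d' ** M ** d"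
    by (simp add: matrix.add_left matrix.add_right d(2))
  moreover have "dist (mat 1 + d' ** M ** d) (mat 1) < \<delta>"
    using d(3) \<delta>(1) by (simp add: dist_norm)
  ultimately show False using \<delta>(2) by (metis dist_real_def less_irrefl)
qed

section \<open>Unipotent matrices and their powers\<close>

text \<open>Rescaling one basis vector normalises the determinant and keeps the matrix triangular.
  Determinant 1 is what lets \<open>a\<close> act on the symmetric space.\<close>

lemma unipotent_similar_unitriangular:
  fixes u :: "real^'n^'n"
  assumes "unipotent u"
  obtains a a' :: "real^'n^'n" and h where "det a = 1" "a' ** a = mat 1" "strictly_triangular h (a' ** (u - mat 1) ** a)"
proof -
  obtain a a' :: "real^'n^'n" and h where a: "a' ** a = mat 1" and h: "strictly_triangular h (a' ** (u - mat 1) ** a)"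
    using assms nilpotent_similar_strictly_triangular unfolding unipotent_def by blast
  have "det a' * det a = 1" using arg_cong[OF a, of det] by (simp add: det_mul)
  then have nz: "det a \<noteq> 0" by auto
  fix i0 :: 'n
  define q where "q i = (if i = i0 then 1 / det a else 1)" for i
  define p where "p i = (if i = i0 then det a else 1)" for i
  define d d' :: "real^'n^'n" where "d = (\<chi> i j. if i = j then q i else 0)"
    and "d' = (\<chi> i j. if i = j then p i else 0)"
  have "det d = (\<Prod>i\<in>UNIV. q i)"
    unfolding d_def by (subst det_diagonal) auto
  also have "\<dots> = 1 / det a" by (simp add: q_def)
  finally have "det (a ** d) = 1" using nz by (simp add: det_mul)
  moreover have "p i * q i = 1" for i using nz by (simp add: p_def q_def)
  then have "d' ** d = mat 1"
    unfolding d_def d'_def diagonal_matrix_mult by (simp add: mat_def cong: if_cong)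
  then have "(d' ** a') ** (a ** d) = mat 1"
    by (metis a matrix_mul_assoc matrix_mul_rid)
  moreover have "strictly_triangular h ((d' ** a') ** (u - mat 1) ** (a ** d))"
    using strictly_triangular_diagonal_conj[OF h, of p q]
    unfolding d_def d'_def by (simp add: matrix_mul_assoc)
  ultimately show ?thesis by (rule that)
qed

text \<open>By \<open>v u - 1 = (v - 1) + (u - 1) + (v - 1) (u - 1)\<close>, as conjugation respects
  sums and products. The same \<open>a\<close> and \<open>h\<close> serve all
  \<open>k\<close>.\<close>

lemma strictly_triangular_power:
  fixes u a a' :: "real^'n^'n"
  assumes "a' ** a = mat 1" and u: "strictly_triangular h (a' ** (u - mat 1) ** a)"
  shows "strictly_triangular h (a' ** (u [^]\<^bsub>SL_group\<^esub> (k::nat) - mat 1) ** a)"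
proof (induction k)
  case 0
  show ?case by (simp add: nat_pow_def strictly_triangular_zero)
next
  case (Suc k)
  let ?v = "u [^]\<^bsub>SL_group\<^esub> k"
  let ?P = "a' ** (?v - mat 1) ** a" and ?Q = "a' ** (u - mat 1) ** a"
  have "a ** a' = mat 1" using assms(1) matrix_left_right_inverse by blast
  then have "X ** a ** a' = X" for X :: "real^'n^'n" by (simp flip: matrix_mul_assoc)
  then have "?P ** ?Q = a' ** ((?v - mat 1) ** (u - mat 1)) ** a"
    by (simp add: matrix_mul_assoc)
  moreover have "?v ** u - mat 1 = (?v - mat 1) + (u - mat 1) + (?v - mat 1) ** (u - mat 1)"
    by (simp add: matrix.diff_left matrix.diff_right)
  ultimately have "a' ** (?v ** u - mat 1) ** a = ?P + ?Q + ?P ** ?Q"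
    by (simp only: matrix.add_left matrix.add_right)
  with Suc u show ?case
    by (simp add: strictly_triangular_add strictly_triangular_mult nat_pow_def)
qed

text \<open>For a nilpotent \<open>N = u - 1 \<noteq> 0\<close> take \<open>W\<close> a power of \<open>N\<close> with \<open>N W \<noteq> 0 = N\<^sup>2 W\<close>; then
  \<open>u\<^sup>k W = W + k N W\<close>.\<close>

lemma unipotent_power_neq_one:
  fixes u :: "real^'n^'n"
  assumes "unipotent u" "u \<noteq> mat 1" "k > 0"
  shows "u [^]\<^bsub>SL_group\<^esub> (k::nat) \<noteq> mat 1"
proof
  define N where "N = u - mat 1"
  have u: "u = mat 1 + N" by (simp add: N_def)
  define pw where "pw j = (((**) N) ^^ j) (mat 1)" for j
  define m where "m = (LEAST j. pw j = 0)"
  have ex: "\<exists>j. pw j = 0" using assms(1) unfolding unipotent_def N_def pw_def by blast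
  then have m: "pw m = 0" unfolding m_def by (rule LeastI_ex)
  have least: "pw j \<noteq> 0" if "j < m" for j using that not_less_Least unfolding m_def by blast
  have N: "N \<noteq> 0" using assms(2) by (simp add: N_def)
  have "N = pw 1" "pw 0 = mat 1" by (simp_all add: pw_def)
  moreover have "mat 1 \<noteq> (0 :: real^'n^'n)" using N by (metis matrix.zero_right matrix_mul_rid)
  \<comment> \<open>Neither \<open>pw 0\<close> nor \<open>pw 1\<close> vanishes, so the exponent
    \<open>m - 2\<close> of \<open>W\<close> makes sense.\<close>
  ultimately have "m \<noteq> 0" "m \<noteq> 1" using m N by metis+
  then obtain l where l: "m = Suc (Suc l)" by (metis One_nat_def not0_implies_Suc)
  define W where "W = pw l"
  have NW: "N ** W \<noteq> 0" using least[of "Suc l"] by (simp add: l W_def pw_def)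
  have NNW: "N ** (N ** W) = 0" using m by (simp add: l W_def pw_def)
  have pow: "u [^]\<^bsub>SL_group\<^esub> (j::nat) ** W = W + real j *\<^sub>R (N ** W)" for j
  proof (induction j)
    case 0
    show ?case by (simp add: nat_pow_def)
  next
    case (Suc j)
    \<comment> \<open>The recursion of the power puts the new factor on the right; the induction
      hypothesis about \<open>u\<close> to the \<open>j\<close> times \<open>W\<close> needs it on
      the left.\<close>
    have "u [^]\<^bsub>SL_group\<^esub> Suc j = u ** u [^]\<^bsub>SL_group\<^esub> j"
    proof (induction j)
      case (Suc j)
      then show ?case by (simp add: nat_pow_def) (metis matrix_mul_assoc)
    qed (simp add: nat_pow_def)
    then have "u [^]\<^bsub>SL_group\<^esub> Suc j ** W = u ** (W + real j *\<^sub>R (N ** W))"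
      by (simp add: Suc flip: matrix_mul_assoc)
    also have "\<dots> = W + N ** W + real j *\<^sub>R (N ** W)"
      by (simp add: u matrix.add_left matrix.add_right matrix.scaleR_right NNW)
    finally show ?case by (simp add: algebra_simps)
  qed
  assume "u [^]\<^bsub>SL_group\<^esub> k = mat 1"
  with pow[of k] NW assms(3) show False by simp
qed


section \<open>Displacement of unipotent matrices\<close>

lemma norm_transpose:
  fixes A :: "real^'n^'m"
  shows "norm (transpose A) = norm A"
proof -
  have "(\<Sum>i\<in>UNIV. \<Sum>j\<in>UNIV. (A $ j $ i)\<^sup>2) = (\<Sum>i\<in>UNIV. \<Sum>j\<in>UNIV. (A $ i $ j)\<^sup>2)"
    by (rule sum.swap)
  then show ?thesis
    by (simp add: norm_vec_def L2_set_def transpose_def sum_nonneg)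
qed

text \<open>If the speed is not integrable, \<open>integral\<close> has the default value 0.\<close>

lemma projected_length_nonneg: "0 \<le> projected_length c"
  unfolding projected_length_def
  by (cases "projected_speed c integrable_on {0..1}")
    (auto intro!: integral_nonneg simp: projected_speed_def Let_def not_integrable_integral)

lemma symmetric_dist_le:
  assumes "c C1_differentiable_on {0..1}" "c ` {0..1} \<subseteq> carrier SL_group" "c 0 \<in> C" "c 1 \<in> D"
  shows "symmetric_dist C D \<le> projected_length c"
  unfolding symmetric_dist_def using assms projected_length_nonneg
  by (intro cInf_lower) (auto intro!: bdd_belowI[of _ 0])

text \<open>The lower bound avoids showing that \<open>SL(n,\<real>)\<close> is connected: the infimum over an empty set of
  curves would be \<open>Inf {}\<close>.\<close>

lemma symmetric_dist_bounded_below: "min 0 (Inf {}) \<le> symmetric_dist C D"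
proof (cases "{projected_length c |c. c C1_differentiable_on {0..1} \<and>
    c ` {0..1} \<subseteq> carrier SL_group \<and> c 0 \<in> C \<and> c 1 \<in> D} = {}")
  case True
  then show ?thesis unfolding symmetric_dist_def by (simp only: min.cobounded2)
next
  case False
  then have "0 \<le> symmetric_dist C D"
    unfolding symmetric_dist_def by (rule cInf_greatest) (auto simp: projected_length_nonneg)
  then show ?thesis by simp
qed

text \<open>The common lower bound of all distances makes the infimum a genuine lower bound, so each
  point gives an upper estimate.\<close>

lemma displacement_le:
  assumes "C \<in> symmetric_space"
  shows "displacement symmetric_space symmetric_dist f \<le> symmetric_dist C (f C)"
  unfolding displacement_def
  using assms symmetric_dist_bounded_below by (intro cINF_lower bdd_belowI2) auto

lemma SO_set_in_symmetric_space: "(SO_set :: (real^'n^'n) set) \<in> symmetric_space"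
  using translate_one[of SO_set]
  by (auto simp: symmetric_space_def LCOSETS_def translate_def intro!: exI[of _ "mat 1"])

text \<open>The curve \<open>1 + t M\<close> stays in \<open>SL(n,\<real>)\<close>, and \<open>V = (1 + t M)\<^sup>-\<^sup>1 M\<close> satisfies \<open>V = M - t M V\<close>,
  which bounds it.\<close>

lemma symmetric_dist_unitriangular_le:
  "\<exists>\<delta>>0. \<forall>h (M::real^'n^'n). strictly_triangular h M \<longrightarrow> norm M \<le> \<delta> \<longrightarrow>
     symmetric_dist SO_set (translate (mat 1 + M) SO_set) \<le> 1"
proof -
  obtain K where K: "K > 0" "\<And>(A::real^'n^'n) (B::real^'n^'n). norm (A ** B) \<le> norm A * norm B * K"
    using bounded_bilinear.pos_bounded[OF bounded_bilinear_matrix_mult[where 'n='n]] by auto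
  \<comment> \<open>With \<open>norm M * K \<le> 1/2\<close> the term \<open>M ** V\<close> costs at
    most half of \<open>norm V\<close> and is absorbed; then
    \<open>norm V \<le> 2 * norm M \<le> 1\<close>.\<close>
  define \<delta> where "\<delta> = min (1/2) (1 / (2 * K))"
  have "\<delta> > 0" using K(1) by (simp add: \<delta>_def)
  moreover have "symmetric_dist SO_set (translate (mat 1 + M) SO_set) \<le> 1"
    if M: "strictly_triangular h M" and le: "norm M \<le> \<delta>" for h and M :: "real^'n^'n"
  proof -
    have M2: "norm M \<le> 1/2" and "norm M \<le> 1 / (2 * K)" using le by (auto simp: \<delta>_def)
    then have MK: "norm M * K \<le> 1/2" using K(1) by (simp add: field_simps)
    define c where "c t = mat 1 + t *\<^sub>R M" for t :: real
    have det: "det (c t) = 1" for t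
      unfolding c_def by (rule det_unitriangular[OF strictly_triangular_scaleR[OF M]])
    have deriv: "(c has_vector_derivative M) (at t)" for t
      unfolding c_def by (auto intro!: derivative_eq_intros)
    have speed: "projected_speed c t \<le> 1" if t: "t \<in> {0..1}" for t
    proof -
      define V where "V = matrix_inv (c t) ** M"
      have "c t ** V = M" unfolding V_def by (simp add: matrix_mul_assoc SL_inverse(2)[OF det])
      then have "V = M - t *\<^sub>R (M ** V)"
        by (simp add: c_def matrix.add_left matrix.scaleR_left algebra_simps)
      then have "norm V \<le> norm M + norm (t *\<^sub>R (M ** V))"
        by (metis norm_triangle_ineq4)
      also have "norm (t *\<^sub>R (M ** V)) \<le> norm (M ** V)"
        using t by (simp add: mult_left_le_one_le)
      also have "norm (M ** V) \<le> (norm M * K) * norm V" using K(2)[of M V] by (simp add: mult_ac)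
      also have "\<dots> \<le> 1/2 * norm V" by (intro mult_right_mono MK) simp
      finally have "norm V \<le> 1" using M2 by simp
      moreover have "norm (V + transpose V) \<le> norm V + norm V"
        using norm_triangle_ineq[of V "transpose V"] by (simp add: norm_transpose)
      ultimately show ?thesis
        by (simp add: projected_speed_def Let_def vector_derivative_at[OF deriv] flip: V_def)
    qed
    have "projected_length c \<le> 1"
    proof (cases "projected_speed c integrable_on {0..1}")
      case True
      then have "projected_length c \<le> integral {0..1} (\<lambda>_::real. 1 :: real)"
        unfolding projected_length_def
        by (rule Henstock_Kurzweil_Integration.integral_le) (auto simp: speed)
      then show ?thesis by simp
    qed (simp add: projected_length_def not_integrable_integral)
    moreover have "symmetric_dist SO_set (translate (mat 1 + M) SO_set) \<le> projected_length c"
    proof (rule symmetric_dist_le)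
      show "c C1_differentiable_on {0..1}"
        unfolding C1_differentiable_on_def using deriv by (intro exI[of _ "\<lambda>_. M"]) auto
      show "c ` {0..1} \<subseteq> carrier SL_group" using det by auto
      have one: "mat 1 \<in> (SO_set :: (real^'n^'n) set)"
        by (simp add: SO_set_def orthogonal_matrix_id)
      then show "c 0 \<in> SO_set" by (simp add: c_def)
      show "c 1 \<in> translate (mat 1 + M) SO_set"
        using one by (force simp: c_def translate_def l_coset_def)
    qed
    ultimately show ?thesis by simp
  qed
  ultimately show ?thesis by blast
qed

text \<open>The test point is the base point moved by \<open>b = a ** d\<close>, with
  \<open>d\<close> shrinking the triangular part. There \<open>g\<close> acts as
  \<open>mat 1 + M\<close> acts at the base point, by invariance of the distance.\<close>

lemma displacement_unitriangular_le:
  fixes g a a' :: "real^'n^'n"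
  assumes a: "det a = 1" "a' ** a = mat 1"
    and h: "strictly_triangular h (a' ** (g - mat 1) ** a)"
  shows "displacement symmetric_space symmetric_dist (translate g) \<le> 1"
proof -
  obtain \<delta> where \<delta>: "\<delta> > 0" "\<And>h (M::real^'n^'n). strictly_triangular h M \<Longrightarrow> norm M \<le> \<delta> \<Longrightarrow>
     symmetric_dist SO_set (translate (mat 1 + M) SO_set) \<le> 1"
    using symmetric_dist_unitriangular_le by blast
  let ?N = "a' ** (g - mat 1) ** a"
  obtain d d' where d: "det d = 1" "d' ** d = mat 1" "strictly_triangular h (d' ** ?N ** d)"
    "norm (d' ** ?N ** d) \<le> \<delta>"
    using strictly_triangular_shrink[OF h \<delta>(1)] by blast
  define b b' where "b = a ** d" and "b' = d' ** a'"
  define M where "M = d' ** ?N ** d"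
  have M: "M = b' ** (g - mat 1) ** b" by (simp add: M_def b_def b'_def matrix_mul_assoc)
  have det: "det b = 1" by (simp add: b_def det_mul a d)
  have "b' ** b = mat 1" unfolding b_def b'_def by (metis a(2) d(2) matrix_mul_assoc matrix_mul_rid)
  then have "b ** b' = mat 1" using matrix_left_right_inverse by blast
  then have "b ** (mat 1 + M) = b + (g - mat 1) ** b"
    by (simp add: M matrix.add_right matrix_mul_assoc)
  then have gb: "g ** b = b ** (mat 1 + M)" by (simp add: matrix.diff_left)
  have "displacement symmetric_space symmetric_dist (translate g)
      \<le> symmetric_dist (translate b SO_set) (translate g (translate b SO_set))"
    by (intro displacement_le translate_in_symmetric_space[OF det] SO_set_in_symmetric_space)
  also have "\<dots> = symmetric_dist SO_set (translate (mat 1 + M) SO_set)"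
    unfolding translate_mult gb by (simp add: symmetric_dist_translate[OF det] flip: translate_mult)
  also have "\<dots> \<le> 1" using \<delta>(2) d(3,4) by (simp add: M_def)
  finally show ?thesis .
qed

theorem corollary5p2p3:
  fixes \<Gamma> :: "('g, 'b) monoid_scheme" and S :: "'g set" and \<rho> :: "'g \<Rightarrow> real^'n^'n"
  assumes "group \<Gamma>"
    and "finite S" and "S \<subseteq> carrier \<Gamma>" and "generate \<Gamma> S = carrier \<Gamma>"
    and "infinite_contortion \<Gamma>"
    and "\<rho> \<in> hom \<Gamma> SL_group"
    and "\<exists>u\<in>\<rho> ` carrier \<Gamma>. unipotent u \<and> u \<noteq> mat 1"
  shows "\<not> well_displacing \<Gamma> S symmetric_space symmetric_dist (\<lambda>\<gamma>. translate (\<rho> \<gamma>))"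
proof -
  interpret group_hom \<Gamma> "SL_group :: (real^'n^'n) monoid" \<rho>
    using assms(1,6) group_SL by (simp add: group_hom_def group_hom_axioms_def)
  obtain \<gamma> where \<gamma>: "\<gamma> \<in> carrier \<Gamma>" and u: "unipotent (\<rho> \<gamma>)" "\<rho> \<gamma> \<noteq> mat 1"
    using assms(7) by blast
  have power: "\<rho> (\<gamma> [^]\<^bsub>\<Gamma>\<^esub> k) = \<rho> \<gamma> [^]\<^bsub>SL_group\<^esub> k" for k :: nat
    using hom_nat_pow[OF \<gamma>] .
  \<comment> \<open>A positive power of \<open>\<gamma>\<close> equal to one would be mapped to a
    trivial power of the unipotent matrix.\<close>
  have "\<not> torsion_element \<Gamma> \<gamma>"
    unfolding torsion_element_def
    using unipotent_power_neq_one[OF u] power hom_one unfolding SL_simps(3) by metis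
  moreover obtain a a' :: "real^'n^'n" and h where a: "det a = 1" "a' ** a = mat 1"
    "strictly_triangular h (a' ** (\<rho> \<gamma> - mat 1) ** a)"
    using unipotent_similar_unitriangular[OF u(1)] .
  \<comment> \<open>The matrices \<open>a\<close>, \<open>a'\<close> and the heights
    \<open>h\<close> are fixed before \<open>k\<close>, and the bound 1 is uniform.\<close>
  have "displacement symmetric_space symmetric_dist (translate (\<rho> (\<gamma> [^]\<^bsub>\<Gamma>\<^esub> k))) \<le> 1" for k :: nat
    unfolding power
    by (rule displacement_unitriangular_le[OF a(1,2) strictly_triangular_power[OF a(2,3)]])
  ultimately show ?thesis
    by (rule G.not_well_displacing_if_bounded_on_powers[OF assms(2-5) \<gamma>])
qed

end
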